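(* Let $n\in\mathbb{N}$, let $X\sim\mathcal{D}$ be a random variable, let $\varphi_X:\mathcal{G}_n\to\mathbb{R}^d$ be a finite-dimensional expectation-complete random graph embedding, and let $f:\mathcal{G}_n\to\mathbb{R}$ be a permutation-invariant function. For any $\varepsilon>0$ and $\delta>0$ there exist an $\ell\in\mathbb{N}$ and a multi-layer perceptron $g:\mathbb{R}^{d\ell}\to\mathbb{R}$ such that, for $X_1,\dots,X_\ell\sim\mathcal{D}$ i.i.d., with probability at least $1-\delta$, $$|f(G)-g(\varphi_{X_1}(G),\dots,\varphi_{X_\ell}(G))|<\varepsilon\quad\text{for all } G\in\mathcal{G}_n .$$
   Context: Graphs are finite, undirected and simple, with at least one vertex. $\mathcal{G}_n$ is the set of all graphs with at most $n$ vertices, considered up to isomorphism (one representative per isomorphism class), so that $\mathcal{G}_n$ is finite. A function on graphs is permutation-invariant if it takes equal values on isomorphic graphs. A random graph embedding $\varphi_X:\mathcal{G}_n\to\mathbb{R}^d$ is a map parameterised by a random variable $X\sim\mathcal{D}$, such that $\mathbb{E}_{X\sim\mathcal{D}}[\varphi_X(G)]$ is defined for all $G\in\mathcal{G}_n$. It is expectation-complete if the map $G\mapsto\mathbb{E}_X[\varphi_X(G)]$ is complete, i.e. permutation-invariant and taking different values on non-isomorphic graphs. A multi-layer perceptron is a standard fully connected feed-forward neural network of arbitrary finite width and depth with an activation function for which the universal approximation theorem holds (e.g. ReLU). *)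

theory Defs
  imports "HOL-Probability.Probability" "Graph_Theory.Graph_Theory"
begin

section \<open>Graphs up to isomorphism\<close>

text \<open>
  A \<open>pair_graph\<close> is finite, loopless, without parallel arcs and has a symmetric arc
  relation, i.e. it is a finite simple undirected graph. With vertices drawn from
  \<open>nat\<close>, every finite graph occurs up to isomorphism.
\<close>

definition graphs_upto :: "nat \<Rightarrow> nat pair_pre_digraph set" where
  "graphs_upto n = {G. pair_graph G \<and> pverts G \<noteq> {} \<and> card (pverts G) \<le> n}"

definition graph_iso :: "nat pair_pre_digraph \<Rightarrow> nat pair_pre_digraph \<Rightarrow> bool" where
  "graph_iso G H \<longleftrightarrow> digraph_iso (with_proj G) (with_proj H)"

lemma graph_iso_iff_bij_betw:
  assumes "pair_graph G" "pair_graph H"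
  shows "graph_iso G H \<longleftrightarrow>
    (\<exists>p. bij_betw p (pverts G) (pverts H) \<and>
      (\<forall>u\<in>pverts G. \<forall>v\<in>pverts G. (u, v) \<in> parcs G \<longleftrightarrow> (p u, p v) \<in> parcs H))"
    (is "_ \<longleftrightarrow> (\<exists>p. ?B p)")
proof
  interpret G: pair_graph G by fact
  interpret H: pair_graph H by fact
  assume "graph_iso G H"
  then obtain h where h: "pre_digraph.digraph_isomorphism (with_proj G) h"
    and eq: "with_proj H = app_iso h (with_proj G)"
    unfolding graph_iso_def digraph_iso_def by blast
  let ?p = "iso_verts h"
  have V: "pverts H = ?p ` pverts G" using arg_cong[OF eq, of verts] by simp
  have A: "parcs H = iso_arcs h ` parcs G" using arg_cong[OF eq, of arcs] by simp
  have t: "iso_tail h = fst" using arg_cong[OF eq, of tail] by simp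
  have hd: "iso_head h = snd" using arg_cong[OF eq, of head] by simp
  have inj: "inj_on ?p (pverts G)"
    using h by (simp add: pre_digraph.digraph_isomorphism_def)
  have arc: "iso_arcs h e = (?p (fst e), ?p (snd e))" if "e \<in> parcs G" for e
    using h that by (simp add: pre_digraph.digraph_isomorphism_def t hd prod_eq_iff)
  have "(u, v) \<in> parcs G \<longleftrightarrow> (?p u, ?p v) \<in> parcs H"
    if uv: "u \<in> pverts G" "v \<in> pverts G" for u v
  proof
    assume "(u, v) \<in> parcs G"
    then show "(?p u, ?p v) \<in> parcs H" using arc[of "(u, v)"] A by force
  next
    assume "(?p u, ?p v) \<in> parcs H"
    then obtain e where e: "e \<in> parcs G" "(?p u, ?p v) = iso_arcs h e" using A by auto
    then have "?p u = ?p (fst e)" "?p v = ?p (snd e)" using arc by auto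
    then have "u = fst e" "v = snd e"
      using inj uv e(1) G.arc_fst_in_verts G.arc_snd_in_verts by (auto dest: inj_onD)
    then show "(u, v) \<in> parcs G" using e(1) by simp
  qed
  then have "?B ?p" using inj V by (auto simp: bij_betw_def)
  then show "\<exists>p. ?B p" by blast
next
  interpret G: pair_graph G by fact
  interpret H: pair_graph H by fact
  assume "\<exists>p. ?B p"
  then obtain p where p: "bij_betw p (pverts G) (pverts H)"
    and pe: "\<And>u v. u \<in> pverts G \<Longrightarrow> v \<in> pverts G \<Longrightarrow> (u, v) \<in> parcs G \<longleftrightarrow> (p u, p v) \<in> parcs H"
    by blast
  let ?a = "\<lambda>e. (p (fst e), p (snd e))"
  let ?h = "\<lparr>iso_verts = p, iso_arcs = ?a, iso_head = snd, iso_tail = fst\<rparr>"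
  have inj: "inj_on p (pverts G)" and V: "pverts H = p ` pverts G"
    using p by (auto simp: bij_betw_def)
  have inja: "inj_on ?a (parcs G)"
    using inj G.arc_fst_in_verts G.arc_snd_in_verts
    by (auto simp: inj_on_def prod_eq_iff)
  have "parcs H = ?a ` parcs G"
  proof (intro equalityI subsetI)
    fix e assume e: "e \<in> parcs H"
    then obtain x y where xy: "e = (x, y)" "x \<in> p ` pverts G" "y \<in> p ` pverts G"
      using H.arc_fst_in_verts[OF e] H.arc_snd_in_verts[OF e] V by (cases e) auto
    then obtain u v where uv: "u \<in> pverts G" "v \<in> pverts G" "e = (p u, p v)" by blast
    then have "(u, v) \<in> parcs G" using pe e by blast
    then have "?a (u, v) \<in> ?a ` parcs G" by (rule imageI)
    then show "e \<in> ?a ` parcs G" using uv(3) by simp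
  next
    fix e assume "e \<in> ?a ` parcs G"
    then obtain u v where uv: "(u, v) \<in> parcs G" "e = (p u, p v)" by auto
    then have "(p u, p v) \<in> parcs H" using pe G.in_arcsD1 G.in_arcsD2 by blast
    then show "e \<in> parcs H" using uv(2) by simp
  qed
  then have "with_proj H = app_iso ?h (with_proj G)"
    using V by (simp add: with_proj_def app_iso_def)
  moreover have "pre_digraph.digraph_isomorphism (with_proj G) ?h"
    using inj inja G.wf_digraph_axioms by (simp add: pre_digraph.digraph_isomorphism_def)
  ultimately show "graph_iso G H" unfolding graph_iso_def digraph_iso_def by blast
qed

text \<open>Exactly one member per isomorphism class of graphs with at most \<open>n\<close> vertices.\<close>

definition graph_representatives :: "nat \<Rightarrow> nat pair_pre_digraph set \<Rightarrow> bool" where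
  "graph_representatives n \<G> \<longleftrightarrow>
     \<G> \<subseteq> graphs_upto n \<and> (\<forall>G\<in>graphs_upto n. \<exists>!H. H \<in> \<G> \<and> graph_iso G H)"

definition permutation_invariant_on ::
    "nat pair_pre_digraph set \<Rightarrow> (nat pair_pre_digraph \<Rightarrow> 'b) \<Rightarrow> bool" where
  "permutation_invariant_on \<G> F \<longleftrightarrow> (\<forall>G\<in>\<G>. \<forall>H\<in>\<G>. graph_iso G H \<longrightarrow> F G = F H)"

definition complete_on ::
    "nat pair_pre_digraph set \<Rightarrow> (nat pair_pre_digraph \<Rightarrow> 'b) \<Rightarrow> bool" where
  "complete_on \<G> F \<longleftrightarrow> permutation_invariant_on \<G> F \<and>
     (\<forall>G\<in>\<G>. \<forall>H\<in>\<G>. \<not> graph_iso G H \<longrightarrow> F G \<noteq> F H)"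

section \<open>Random graph embeddings\<close>

text \<open>
  Vectors of variable dimension \<open>m\<close> are points of \<open>Euclidean_space m\<close>: functions on
  \<open>nat\<close> vanishing at all indices \<open>\<ge> m\<close>. Expectations are therefore taken componentwise,
  and being defined means that every component is integrable.
\<close>

definition random_graph_embedding ::
    "'x measure \<Rightarrow> nat \<Rightarrow> nat pair_pre_digraph set \<Rightarrow>
      ('x \<Rightarrow> nat pair_pre_digraph \<Rightarrow> nat \<Rightarrow> real) \<Rightarrow> bool" where
  "random_graph_embedding D d \<G> \<phi> \<longleftrightarrow> prob_space D \<and>
     (\<forall>G\<in>\<G>. (\<forall>x\<in>space D. \<phi> x G \<in> topspace (Euclidean_space d)) \<and>
             (\<forall>i<d. integrable D (\<lambda>x. \<phi> x G i)))"

definition expected_embedding ::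
    "'x measure \<Rightarrow> ('x \<Rightarrow> nat pair_pre_digraph \<Rightarrow> nat \<Rightarrow> real) \<Rightarrow>
      nat pair_pre_digraph \<Rightarrow> nat \<Rightarrow> real" where
  "expected_embedding D \<phi> G = (\<lambda>i. \<integral>x. \<phi> x G i \<partial>D)"

definition expectation_complete ::
    "'x measure \<Rightarrow> nat pair_pre_digraph set \<Rightarrow>
      ('x \<Rightarrow> nat pair_pre_digraph \<Rightarrow> nat \<Rightarrow> real) \<Rightarrow> bool" where
  "expectation_complete D \<G> \<phi> \<longleftrightarrow> complete_on \<G> (expected_embedding D \<phi>)"

definition concat_vec :: "nat \<Rightarrow> nat \<Rightarrow> (nat \<Rightarrow> nat \<Rightarrow> real) \<Rightarrow> nat \<Rightarrow> real" where
  "concat_vec d l v = (\<lambda>k. if k < d * l then v (k div d) (k mod d) else 0)"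

section \<open>Multi-layer perceptrons\<close>

definition dense_layer ::
    "(real \<Rightarrow> real) \<Rightarrow> nat \<Rightarrow> nat \<Rightarrow> (nat \<Rightarrow> nat \<Rightarrow> real) \<Rightarrow> (nat \<Rightarrow> real) \<Rightarrow>
      (nat \<Rightarrow> real) \<Rightarrow> nat \<Rightarrow> real" where
  "dense_layer \<sigma> m k W b x = (\<lambda>i. if i < k then \<sigma> ((\<Sum>j<m. W i j * x j) + b i) else 0)"

text \<open>
  \<open>mlp \<sigma> m g\<close>: \<open>g\<close> is computed by a network with input dimension \<open>m\<close>, at least one
  hidden layer with activation \<open>\<sigma>\<close>, and an affine scalar output layer.
\<close>

inductive mlp :: "(real \<Rightarrow> real) \<Rightarrow> nat \<Rightarrow> ((nat \<Rightarrow> real) \<Rightarrow> real) \<Rightarrow> bool" for \<sigma> where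
  one_hidden: "0 < k \<Longrightarrow>
    mlp \<sigma> m (\<lambda>x. (\<Sum>i<k. a i * dense_layer \<sigma> m k W b x i) + c)"
| more_hidden: "0 < k \<Longrightarrow> mlp \<sigma> k g \<Longrightarrow>
    mlp \<sigma> m (\<lambda>x. g (dense_layer \<sigma> m k W b x))"

text \<open>
  The universal approximation property of an activation function: uniform density in the
  continuous functions on every compact subset of every \<open>\<real>\<^sup>m\<close>. Measurability makes
  network outputs on random inputs random variables.
\<close>

definition universal_activation :: "(real \<Rightarrow> real) \<Rightarrow> bool" where
  "universal_activation \<sigma> \<longleftrightarrow> \<sigma> \<in> borel_measurable borel \<and>
     (\<forall>m K h \<epsilon>. compactin (Euclidean_space m) K \<longrightarrow>
        continuous_map (subtopology (Euclidean_space m) K) euclideanreal h \<longrightarrow> 0 < \<epsilon> \<longrightarrow>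
        (\<exists>g. mlp \<sigma> m g \<and> (\<forall>x\<in>K. \<bar>h x - g x\<bar> < \<epsilon>)))"

end

theory Submission
  imports Defs "HOL-Real_Asymp.Real_Asymp"
begin

text \<open>
  There are only finitely many representatives, so by dominated convergence the coordinates
  can be clamped to an interval \<open>[-A, A]\<close> without making two expected embeddings coincide.
  Let \<open>L\<close> be a polynomial on \<open>\<real>\<^sup>d\<close> taking the value \<open>f G\<close> at the clamped
  expectation of \<open>G\<close>. By Hoeffding's inequality the mean of \<open>l\<close> clamped samples is close to
  this expectation, so \<open>L\<close> of the mean is a continuous function of the \<open>l\<close> samples that
  approximates \<open>f\<close>; clamping makes the square integrability of \<open>\<phi>\<close> unnecessary. With \<open>l\<close>
  fixed, Markov's inequality confines the samples to a compact box with high probability,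
  and universal approximation on this box replaces \<open>L\<close> of the mean by a perceptron.
\<close>

section \<open>Finiteness of a system of representatives\<close>

lemma graph_representatives_iso_eq:
  assumes "graph_representatives n \<G>" "G \<in> \<G>" "H \<in> \<G>" "graph_iso G H"
  shows "G = H"
proof -
  have G: "G \<in> graphs_upto n"
    using assms by (auto simp: graph_representatives_def)
  then have "pair_graph G"
    by (simp add: graphs_upto_def)
  then have "graph_iso G G"
    by (auto simp: graph_iso_iff_bij_betw intro: exI[of _ id])
  then show ?thesis
    using assms G unfolding graph_representatives_def by blast
qed

text \<open>Relabel each graph by an initial segment of \<open>nat\<close>. The number of vertices
  and the relabelled arc set determine the graph up to isomorphism, hence as a representative, and
  only finitely many such codes exist.\<close>

lemma finite_graph_representatives:
  assumes rep: "graph_representatives n \<G>"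
  shows "finite \<G>"
proof -
  have gr: "pair_graph G" "card (pverts G) \<le> n" if "G \<in> \<G>" for G
    using that rep by (auto simp: graph_representatives_def graphs_upto_def)
  have fin: "finite (pverts G)" if "G \<in> \<G>" for G
  proof -
    interpret pair_graph G using gr that by blast
    show ?thesis by (rule pair_finite_verts)
  qed
  have "\<forall>G\<in>\<G>. \<exists>p. bij_betw p (pverts G) {..<card (pverts G)}"
    using fin by (metis atLeast0LessThan ex_bij_betw_finite_nat)
  then obtain p where p: "\<And>G. G \<in> \<G> \<Longrightarrow> bij_betw (p G) (pverts G) {..<card (pverts G)}"
    by metis
  define code where "code = (\<lambda>G. (card (pverts G), map_prod (p G) (p G) ` parcs G))"
  have "inj_on code \<G>"
  proof (rule inj_onI)
    fix G H assume GH: "G \<in> \<G>" "H \<in> \<G>" "code G = code H"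
    interpret G: pair_graph G using gr GH by blast
    interpret H: pair_graph H using gr GH by blast
    have c: "card (pverts G) = card (pverts H)"
      and e: "map_prod (p G) (p G) ` parcs G = map_prod (p H) (p H) ` parcs H"
      using GH(3) by (auto simp: code_def)
    \<comment> \<open>By injectivity of the labelling, adjacency can be read back from the
      relabelled arc set.\<close>
    have arc: "(u, v) \<in> parcs K \<longleftrightarrow> (p K u, p K v) \<in> map_prod (p K) (p K) ` parcs K"
      if "K \<in> \<G>" "u \<in> pverts K" "v \<in> pverts K" for K u v
    proof -
      interpret K: pair_graph K using gr that by blast
      have "inj_on (p K) (pverts K)"
        using p[OF that(1)] by (simp add: bij_betw_def)
      then show ?thesis
        using that by (auto dest: inj_onD K.in_arcsD1 K.in_arcsD2)
    qed
    \<comment> \<open>\<open>q\<close> matches the vertices of \<open>G\<close> and \<open>H\<close>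
      that carry the same label; equal codes make it an isomorphism.\<close>
    define q where "q = inv_into (pverts H) (p H) \<circ> p G"
    have q: "bij_betw q (pverts G) (pverts H)"
      unfolding q_def using p[OF GH(1)] bij_betw_inv_into[OF p[OF GH(2)]]
      by (auto simp: c intro: bij_betw_trans)
    have pq: "p H (q u) = p G u" if "u \<in> pverts G" for u
      using that p[OF GH(1)] p[OF GH(2)] c
      by (auto simp: q_def bij_betw_def intro!: f_inv_into_f)
    have "(u, v) \<in> parcs G \<longleftrightarrow> (q u, q v) \<in> parcs H"
      if uv: "u \<in> pverts G" "v \<in> pverts G" for u v
    proof -
      have "q u \<in> pverts H" "q v \<in> pverts H"
        using q uv by (auto simp: bij_betw_def)
      then show ?thesis
        using arc[OF GH(1) uv] arc[OF GH(2)] e uv by (simp add: pq)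
    qed
    with q have "graph_iso G H"
      using G.pair_graph H.pair_graph by (auto simp: graph_iso_iff_bij_betw)
    then show "G = H"
      using graph_representatives_iso_eq rep GH by blast
  qed
  moreover have "code ` \<G> \<subseteq> {..n} \<times> Pow ({..<n} \<times> {..<n})"
  proof (intro image_subsetI)
    fix G assume G: "G \<in> \<G>"
    interpret pair_graph G using gr G by blast
    have "p G u < n" if "u \<in> pverts G" for u
      using bij_betwE[OF p[OF G]] gr(2)[OF G] that by fastforce
    then show "code G \<in> {..n} \<times> Pow ({..<n} \<times> {..<n})"
      using gr(2)[OF G] by (auto simp: code_def dest: in_arcsD1 in_arcsD2)
  qed
  ultimately show ?thesis
    by (meson finite_Pow_iff finite_SigmaI finite_atMost finite_lessThan inj_on_finite)
qed

section \<open>Perceptrons: measurability, and the compact sets for universal approximation\<close>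

text \<open>Induction over the layers with the random input \<open>x\<close> generalised: a further
  hidden layer replaces the input by the output of that layer. A network reads only its first
  \<open>m\<close> inputs, so measurability is asked of these alone.\<close>

lemma mlp_measurable:
  assumes "mlp \<sigma> m g" and [measurable]: "\<sigma> \<in> borel_measurable borel"
    and "\<And>j. j < m \<Longrightarrow> (\<lambda>\<omega>. x \<omega> j) \<in> borel_measurable M"
  shows "(\<lambda>\<omega>. g (x \<omega>)) \<in> borel_measurable M"
proof -
  have layer: "(\<lambda>\<omega>. dense_layer \<sigma> m k W b (x \<omega>) i) \<in> borel_measurable M"
    if "\<And>j. j < m \<Longrightarrow> (\<lambda>\<omega>. x \<omega> j) \<in> borel_measurable M"
    for m k W b i and x :: "'a \<Rightarrow> nat \<Rightarrow> real"
  proof -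
    have "(\<lambda>\<omega>. (\<Sum>j<m. W i j * x \<omega> j) + b i) \<in> borel_measurable M"
      using that by (intro borel_measurable_add borel_measurable_sum borel_measurable_times) auto
    then show ?thesis
      by (simp add: dense_layer_def)
  qed
  show ?thesis
    using assms(1,3)
  proof (induction arbitrary: x)
    case (one_hidden k m a W b c)
    then show ?case
      using layer[of m x]
      by (intro borel_measurable_add borel_measurable_sum borel_measurable_times) auto
  next
    case (more_hidden k g m W b)
    then show ?case
      using layer[of m x] by simp
  qed
qed

lemma universal_activation_approximation:
  assumes "universal_activation \<sigma>" "compactin (Euclidean_space m) K"
    "continuous_map (subtopology (Euclidean_space m) K) euclideanreal h" "0 < \<epsilon>"
  shows "\<exists>g. mlp \<sigma> m g \<and> (\<forall>x\<in>K. \<bar>h x - g x\<bar> < \<epsilon>)"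
  using assms(1)[unfolded universal_activation_def, THEN conjunct2, rule_format, OF assms(2-4)] .

text \<open>The box is a full product with the factor \<open>{-B..B}\<close> below \<open>m\<close>
  and \<open>{0}\<close> from \<open>m\<close> on, so it is compact by Tychonoff's theorem.\<close>

lemma compactin_Euclidean_space_box:
  "compactin (Euclidean_space m) {x. (\<forall>k<m. \<bar>x k\<bar> \<le> B) \<and> (\<forall>k\<ge>m. x k = 0)}"
proof -
  have "(\<forall>k<m. \<bar>x k\<bar> \<le> B) \<and> (\<forall>k\<ge>m. x k = 0) \<longleftrightarrow>
      (\<forall>k. x k \<in> (if k < m then {-B..B} else {0}))" for x :: "nat \<Rightarrow> real"
    by (auto simp: abs_le_iff minus_le_iff not_less split: if_split)
  then have "{x. (\<forall>k<m. \<bar>x k\<bar> \<le> B) \<and> (\<forall>k\<ge>m. x k = 0)} =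
      (\<Pi>\<^sub>E k\<in>UNIV. if k < m then {-B..B} else {0})"
    by (simp add: PiE_UNIV_domain Pi_def)
  moreover have "compactin (powertop_real UNIV) (\<Pi>\<^sub>E k\<in>UNIV. if k < m then {-B..B} else {0})"
    by (auto simp: compactin_PiE)
  ultimately show ?thesis
    by (auto simp: Euclidean_space_def compactin_subtopology)
qed

section \<open>Polynomial interpolation at finitely many points\<close>

text \<open>Lagrange's formula in several variables: the linear factors are replaced by squared
  Euclidean distances to the other nodes, so the result is still a polynomial in
  \<open>y\<close>.\<close>

definition lagrange_interpolant ::
    "nat \<Rightarrow> 'g set \<Rightarrow> ('g \<Rightarrow> nat \<Rightarrow> real) \<Rightarrow> ('g \<Rightarrow> real) \<Rightarrow> (nat \<Rightarrow> real) \<Rightarrow> real" where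
  "lagrange_interpolant d S \<mu> f y =
     (\<Sum>G\<in>S. f G * (\<Prod>H\<in>S - {G}. (\<Sum>i<d. (y i - \<mu> H i)\<^sup>2) / (\<Sum>i<d. (\<mu> G i - \<mu> H i)\<^sup>2)))"

text \<open>Separation makes every denominator nonzero. In the product for \<open>K = G\<close> all
  factors are 1; for any other \<open>K\<close> the factor with \<open>H = G\<close>
  vanishes.\<close>

lemma lagrange_interpolant_node:
  assumes "finite S" "G \<in> S"
    and sep: "\<And>G H. G \<in> S \<Longrightarrow> H \<in> S \<Longrightarrow> G \<noteq> H \<Longrightarrow> \<exists>i<d. \<mu> G i \<noteq> \<mu> H i"
  shows "lagrange_interpolant d S \<mu> f (\<mu> G) = f G"
proof -
  have nz: "(\<Sum>i<d. (\<mu> G i - \<mu> H i)\<^sup>2) \<noteq> 0" if "G \<in> S" "H \<in> S" "G \<noteq> H" for G H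
    using sep[OF that] by (auto simp: sum_nonneg_eq_0_iff)
  have "(\<Prod>H\<in>S - {K}. (\<Sum>i<d. (\<mu> G i - \<mu> H i)\<^sup>2) / (\<Sum>i<d. (\<mu> K i - \<mu> H i)\<^sup>2)) =
      (if K = G then 1 else 0)" if "K \<in> S" for K
  proof (cases "K = G")
    case True
    then have "(\<Prod>H\<in>S - {K}. (\<Sum>i<d. (\<mu> G i - \<mu> H i)\<^sup>2) / (\<Sum>i<d. (\<mu> K i - \<mu> H i)\<^sup>2)) = 1"
      using nz[OF assms(2)] by (intro prod.neutral ballI) (metis DiffE divide_self insertI1)
    then show ?thesis using True by simp
  next
    case False
    then show ?thesis using assms(1,2) by (auto intro!: bexI[of _ G])
  qed
  then have "lagrange_interpolant d S \<mu> f (\<mu> G) = (\<Sum>K\<in>S. f K * (if K = G then 1 else 0))"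
    unfolding lagrange_interpolant_def by (intro sum.cong) auto
  then show ?thesis
    using assms(1,2) by (simp add: if_distrib cong: if_cong)
qed

text \<open>Continuity at \<open>z\<close>, measured only in the first \<open>d\<close> coordinates.
  If it failed, points within 1/(N+1) of \<open>z\<close> would form a sequence contradicting the
  limit rules for sums and products.\<close>

lemma lagrange_interpolant_near:
  assumes "\<epsilon> > 0"
  obtains \<eta> where "\<eta> > 0" "\<And>y. (\<And>i. i < d \<Longrightarrow> \<bar>y i - z i\<bar> < \<eta>) \<Longrightarrow>
    \<bar>lagrange_interpolant d S \<mu> f y - lagrange_interpolant d S \<mu> f z\<bar> < \<epsilon>"
proof (rule ccontr)
  let ?L = "lagrange_interpolant d S \<mu> f"
  assume "\<not> thesis"
  then have "\<exists>y. (\<forall>i<d. \<bar>y i - z i\<bar> < inverse (real (Suc N))) \<and> \<epsilon> \<le> \<bar>?L y - ?L z\<bar>" for N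
    using that[of "inverse (real (Suc N))"] by (force simp: not_less)
  then obtain y where y: "\<And>N i. i < d \<Longrightarrow> \<bar>y N i - z i\<bar> < inverse (real (Suc N))"
    and far: "\<And>N. \<epsilon> \<le> \<bar>?L (y N) - ?L z\<bar>"
    by metis
  have lim: "(\<lambda>N. y N i) \<longlonglongrightarrow> z i" if "i < d" for i
  proof -
    have "(\<lambda>N. y N i - z i) \<longlonglongrightarrow> 0"
      using y[OF that] by (intro Lim_null_comparison[OF _ LIMSEQ_inverse_real_of_nat])
        (auto intro: always_eventually less_imp_le)
    then show ?thesis by (simp add: LIM_zero_iff)
  qed
  have "(\<lambda>N. ?L (y N)) \<longlonglongrightarrow> ?L z"
    \<comment> \<open>The denominators are constants, possibly zero here because the nodes need not
      be distinct; as constant factors \<open>inverse c\<close> they pass through the limit.\<close>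
    unfolding lagrange_interpolant_def divide_inverse by (intro tendsto_intros lim) auto
  then have "eventually (\<lambda>N. dist (?L (y N)) (?L z) < \<epsilon>) sequentially"
    using assms by (rule tendstoD)
  then show False
    using far by (auto simp: dist_real_def not_less[symmetric] eventually_sequentially)
qed

lemma continuous_on_lagrange_interpolant_mean:
  "continuous_on UNIV (\<lambda>x. lagrange_interpolant d S \<mu> f
     (\<lambda>i. (\<Sum>j<l. max (-A) (min A (x (j * d + i)))) / real l))"
  unfolding lagrange_interpolant_def divide_inverse
  by (intro continuous_intros continuous_on_product_coordinates)

section \<open>Clamping, tails and concentration\<close>

text \<open>Dominated convergence with majorant \<open>\<bar>u x\<bar>\<close>: at each point the
  clamp is inactive as soon as \<open>N\<close> exceeds this value.\<close>

lemma integral_clamp_tendsto: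
  fixes u :: "'x \<Rightarrow> real"
  assumes "integrable D u"
  shows "(\<lambda>N. \<integral>x. max (- real N) (min (real N) (u x)) \<partial>D) \<longlonglongrightarrow> (\<integral>x. u x \<partial>D)"
proof (rule integral_dominated_convergence)
  show "integrable D (\<lambda>x. \<bar>u x\<bar>)"
    using assms by simp
  show "AE x in D. (\<lambda>N. max (- real N) (min (real N) (u x))) \<longlonglongrightarrow> u x"
  proof (intro AE_I2 tendsto_eventually)
    fix x
    obtain N0 :: nat where "\<bar>u x\<bar> \<le> real N0"
      using real_arch_simple by blast
    then have "max (- real N) (min (real N) (u x)) = u x" if "N \<ge> N0" for N
      using that by (auto simp: abs_le_iff max_def min_def)
    then show "eventually (\<lambda>N. max (- real N) (min (real N) (u x)) = u x) sequentially"
      by (auto simp: eventually_sequentially)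
  qed
  have [measurable]: "u \<in> borel_measurable D"
    using assms by auto
  show "(\<lambda>x. max (- real N) (min (real N) (u x))) \<in> borel_measurable D" for N
    by measurable
  show "AE x in D. norm (max (- real N) (min (real N) (u x))) \<le> \<bar>u x\<bar>" for N
    by (intro AE_I2) (auto simp: max_def min_def)
qed (use assms in auto)

text \<open>Markov's inequality for the absolute value of \<open>u\<close>. The threshold
  \<open>Suc N\<close> is positive even for \<open>N = 0\<close>, so the bound holds for all
  \<open>N\<close>.\<close>

lemma tail_probability_tendsto_0:
  fixes u :: "'x \<Rightarrow> real"
  assumes "integrable D u"
  shows "(\<lambda>N. measure D {x \<in> space D. \<bar>u x\<bar> \<ge> real (Suc N)}) \<longlonglongrightarrow> 0"
proof (rule Lim_null_comparison)
  show "eventually (\<lambda>N. norm (measure D {x \<in> space D. \<bar>u x\<bar> \<ge> real (Suc N)}) \<le>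
      (\<integral>x. \<bar>u x\<bar> \<partial>D) * inverse (real (Suc N))) sequentially"
    using assms integral_Markov_inequality_measure[of D "\<lambda>x. \<bar>u x\<bar>" "{}"]
    by (intro always_eventually) (auto simp: divide_inverse)
  show "(\<lambda>N. (\<integral>x. \<bar>u x\<bar> \<partial>D) * inverse (real (Suc N))) \<longlonglongrightarrow> 0"
    using tendsto_mult_right_zero[OF LIMSEQ_inverse_real_of_nat] by simp
qed

text \<open>Hoeffding's inequality for the i.i.d. variables \<open>u (X j \<omega>)\<close>; they
  lie in an interval of length \<open>2 * A\<close>, the source of the denominator in the exponent.
  \<open>X 0\<close>, which exists as \<open>0 < l\<close>, serves as the common reference
  variable.\<close>

lemma (in prob_space) empirical_mean_concentration:
  fixes u :: "'x \<Rightarrow> real"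
  assumes indep: "indep_vars (\<lambda>_. D) X {..<l}"
    and distr: "\<And>i. i < l \<Longrightarrow> distr M D (X i) = D"
    and u [measurable]: "u \<in> borel_measurable D"
    and bound: "\<And>x. x \<in> space D \<Longrightarrow> \<bar>u x\<bar> \<le> A"
    and "0 < A" "0 \<le> \<eta>" "0 < l"
  shows "prob {\<omega> \<in> space M. \<bar>(\<Sum>j<l. u (X j \<omega>)) / real l - (\<integral>x. u x \<partial>D)\<bar> \<ge> \<eta>}
    \<le> 2 * exp (- 2 * real l * \<eta>\<^sup>2 / (2 * A)\<^sup>2)"
proof -
  have X [measurable]: "X j \<in> measurable M D" if "j < l" for j
    using indep that by (auto simp: indep_vars_def)
  have dist_u: "distr M borel (\<lambda>\<omega>. u (X j \<omega>)) = distr D borel u" if "j < l" for j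
    using distr_distr[OF u X[OF that]] distr[OF that] by (simp add: comp_def)
  have m0: "(\<lambda>\<omega>. u (X 0 \<omega>)) \<in> borel_measurable M"
    using u X[of 0] \<open>0 < l\<close> by measurable
  have iid: "iid_interval_bounded_random_variables M {..<l} (\<lambda>j \<omega>. u (X j \<omega>)) (\<lambda>\<omega>. u (X 0 \<omega>)) (-A) A"
  proof unfold_locales
    show "indep_vars (\<lambda>_. borel) (\<lambda>j \<omega>. u (X j \<omega>)) {..<l}"
      by (rule indep_vars_compose2[OF indep]) simp
    show "AE \<omega> in M. u (X 0 \<omega>) \<in> {-A..A}"
      using bound measurable_space[OF X[of 0]] \<open>0 < l\<close>
      by (intro AE_I2) (auto simp: abs_le_iff minus_le_iff)
    show "distr M borel (\<lambda>\<omega>. u (X j \<omega>)) = distr M borel (\<lambda>\<omega>. u (X 0 \<omega>))" if "j \<in> {..<l}" for j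
      using dist_u[of j] dist_u[of 0] that \<open>0 < l\<close> by simp
  qed (rule finite_lessThan m0)+
  have "expectation (\<lambda>\<omega>. u (X 0 \<omega>)) = (\<integral>x. u x \<partial>D)"
    using integral_distr[OF X[of 0] u] distr[of 0] \<open>0 < l\<close> by simp
  then show ?thesis
    using Hoeffding_ineq_iid.Hoeffding_ineq_abs_ge'[OF Hoeffding_ineq_iid.intro[OF iid], of \<eta>] assms
    by (simp add: lessThan_empty_iff)
qed

text \<open>For a single pair, the difference of the clamped expectations in a separating coordinate
  tends to a nonzero limit, so it is eventually nonzero. Finitely many pairs share one
  level.\<close>

lemma separating_clamp_level:
  fixes \<phi> :: "'x \<Rightarrow> 'g \<Rightarrow> nat \<Rightarrow> real"
  assumes "finite S"
    and int: "\<And>G i. G \<in> S \<Longrightarrow> i < d \<Longrightarrow> integrable D (\<lambda>x. \<phi> x G i)"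
    and sep: "\<And>G H. G \<in> S \<Longrightarrow> H \<in> S \<Longrightarrow> G \<noteq> H \<Longrightarrow>
      \<exists>i<d. (\<integral>x. \<phi> x G i \<partial>D) \<noteq> (\<integral>x. \<phi> x H i \<partial>D)"
  shows "\<exists>A>0. \<forall>G\<in>S. \<forall>H\<in>S. G \<noteq> H \<longrightarrow>
    (\<exists>i<d. (\<integral>x. max (-A) (min A (\<phi> x G i)) \<partial>D) \<noteq> (\<integral>x. max (-A) (min A (\<phi> x H i)) \<partial>D))"
proof -
  let ?c = "\<lambda>N G i. \<integral>x. max (- real N) (min (real N) (\<phi> x G i)) \<partial>D"
  have "eventually (\<lambda>N. \<exists>i<d. ?c N G i \<noteq> ?c N H i) sequentially"
    if GH: "G \<in> S" "H \<in> S" "G \<noteq> H" for G H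
  proof -
    obtain i where i: "i < d" "(\<integral>x. \<phi> x G i \<partial>D) - (\<integral>x. \<phi> x H i \<partial>D) \<noteq> 0"
      using sep[OF GH] by auto
    have "(\<lambda>N. ?c N G i - ?c N H i) \<longlonglongrightarrow> (\<integral>x. \<phi> x G i \<partial>D) - (\<integral>x. \<phi> x H i \<partial>D)"
      using int i(1) GH by (intro tendsto_diff integral_clamp_tendsto) auto
    then have "eventually (\<lambda>N. ?c N G i - ?c N H i \<noteq> 0) sequentially"
      using i(2) by (rule tendsto_imp_eventually_ne)
    then show ?thesis
      by eventually_elim (use i(1) in auto)
  qed
  then have "eventually (\<lambda>N. \<forall>G\<in>S. \<forall>H\<in>S. G \<noteq> H \<longrightarrow> (\<exists>i<d. ?c N G i \<noteq> ?c N H i)) sequentially"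
    using \<open>finite S\<close> by (simp add: eventually_ball_finite)
  \<comment> \<open>Requiring \<open>N > 0\<close> makes the level \<open>A = real N\<close>
    positive, as Hoeffding's bound demands.\<close>
  then have "eventually (\<lambda>N. N > 0 \<and> (\<forall>G\<in>S. \<forall>H\<in>S. G \<noteq> H \<longrightarrow> (\<exists>i<d. ?c N G i \<noteq> ?c N H i))) sequentially"
    using eventually_gt_at_top by (rule eventually_conj[rotated])
  then obtain N :: nat where N: "N > 0"
      "\<forall>G\<in>S. \<forall>H\<in>S. G \<noteq> H \<longrightarrow> (\<exists>i<d. ?c N G i \<noteq> ?c N H i)"
    using eventually_happens'[OF sequentially_bot] by blast
  then show ?thesis
    by (intro exI[of _ "real N"]) simp
qed

section \<open>Coordinates of the concatenated samples\<close>

lemma concat_vec_nth: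
  assumes "i < d" "j < l"
  shows "concat_vec d l v (j * d + i) = v j i"
proof -
  have "j * d + i < Suc j * d" using assms by simp
  also have "\<dots> \<le> l * d" using assms by (intro mult_le_mono1) auto
  finally have "j * d + i < d * l" by (simp only: mult.commute[of d])
  then show ?thesis
    using assms by (simp add: concat_vec_def)
qed

text \<open>The indices \<open>i\<close> and \<open>j\<close> are chosen before \<open>v\<close>.
  Measurability needs this: one coordinate of the random concatenation is the same coordinate of the
  same sample for every outcome.\<close>

lemma concat_vec_cases:
  assumes "k < d * l"
  shows "\<exists>i<d. \<exists>j<l. \<forall>v. concat_vec d l v k = v j i"
proof -
  have "d > 0" using assms by (cases d) auto
  moreover have "k div d < l"
    using assms by (intro less_mult_imp_div_less) (simp only: mult.commute[of l])
  ultimately show ?thesis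
    using assms by (intro exI[of _ "k mod d"] exI[of _ "k div d"] conjI) (auto simp: concat_vec_def)
qed

section \<open>The approximation theorem for finite sets, and its application to graphs\<close>

text \<open>Graphs enter only through a finite index set whose expectations are pairwise distinct.
  \<open>l\<close> and \<open>g\<close> are fixed before \<open>M\<close> and \<open>X\<close>, so
  one network serves every i.i.d. sample from \<open>D\<close>.\<close>

theorem mlp_approximation_of_separating_embedding:
  fixes \<phi> :: "'x \<Rightarrow> 'g \<Rightarrow> nat \<Rightarrow> real" and f :: "'g \<Rightarrow> real"
  assumes "finite S"
    and int: "\<And>G i. G \<in> S \<Longrightarrow> i < d \<Longrightarrow> integrable D (\<lambda>x. \<phi> x G i)"
    and sep: "\<And>G H. G \<in> S \<Longrightarrow> H \<in> S \<Longrightarrow> G \<noteq> H \<Longrightarrow>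
      \<exists>i<d. (\<integral>x. \<phi> x G i \<partial>D) \<noteq> (\<integral>x. \<phi> x H i \<partial>D)"
    and \<sigma>: "universal_activation \<sigma>" and "\<epsilon> > 0" "\<delta> > 0"
  shows "\<exists>l\<ge>1. \<exists>g. mlp \<sigma> (d * l) g \<and>
    (\<forall>(M :: 'w measure) X.
       prob_space M \<longrightarrow>
       prob_space.indep_vars M (\<lambda>_. D) X {..<l} \<longrightarrow>
       (\<forall>i<l. distr M D (X i) = D) \<longrightarrow>
       measure M {\<omega> \<in> space M. \<forall>G\<in>S.
         \<bar>f G - g (concat_vec d l (\<lambda>i. \<phi> (X i \<omega>) G))\<bar> < \<epsilon>} \<ge> 1 - \<delta>)"
proof -
  obtain A where A: "A > 0" and sepA: "\<forall>G\<in>S. \<forall>H\<in>S. G \<noteq> H \<longrightarrow>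
      (\<exists>i<d. (\<integral>x. max (-A) (min A (\<phi> x G i)) \<partial>D) \<noteq> (\<integral>x. max (-A) (min A (\<phi> x H i)) \<partial>D))"
    using separating_clamp_level[where D = D and d = d and \<phi> = \<phi>, OF \<open>finite S\<close> int sep] by blast
  define \<mu> where "\<mu> G i = (\<integral>x. max (-A) (min A (\<phi> x G i)) \<partial>D)" for G i
  let ?L = "lagrange_interpolant d S \<mu> f"
  have node: "?L (\<mu> G) = f G" if "G \<in> S" for G
    using \<open>finite S\<close> that sepA unfolding \<mu>_def by (intro lagrange_interpolant_node) auto
  have "\<exists>\<eta>>0. \<forall>y. (\<forall>i<d. \<bar>y i - \<mu> G i\<bar> < \<eta>) \<longrightarrow> \<bar>?L y - f G\<bar> < \<epsilon> / 2" if "G \<in> S" for G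
    by (rule lagrange_interpolant_near[of "\<epsilon> / 2" d "\<mu> G" S \<mu> f])
      (use \<open>\<epsilon> > 0\<close> node[OF that] in auto)
  then obtain \<eta>' where \<eta>': "\<And>G. G \<in> S \<Longrightarrow> \<eta>' G > 0"
    "\<And>G y. G \<in> S \<Longrightarrow> (\<And>i. i < d \<Longrightarrow> \<bar>y i - \<mu> G i\<bar> < \<eta>' G) \<Longrightarrow> \<bar>?L y - f G\<bar> < \<epsilon> / 2"
    by (metis (lifting))
  \<comment> \<open>The element 1 keeps the minimum well defined for empty \<open>S\<close>.\<close>
  define \<eta> where "\<eta> = Min (insert 1 (\<eta>' ` S))"
  have \<eta>: "\<eta> > 0" and \<eta>_le: "\<And>G. G \<in> S \<Longrightarrow> \<eta> \<le> \<eta>' G"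
    using \<open>finite S\<close> \<eta>'(1) by (auto simp: \<eta>_def)
  have near: "\<bar>?L y - f G\<bar> < \<epsilon> / 2" if "G \<in> S" "\<And>i. i < d \<Longrightarrow> \<bar>y i - \<mu> G i\<bar> < \<eta>" for G y
    using that \<eta>_le[OF that(1)] by (intro \<eta>'(2)) (auto intro: less_le_trans)
  define I where "I = S \<times> {..<d}"
  have finI: "finite I" using \<open>finite S\<close> by (simp add: I_def)
  \<comment> \<open>Each pair in \<open>I\<close> contributes \<open>\<kappa>\<close> for its mean and \<open>\<kappa>\<close> for its tails; the \<open>+ 1\<close> covers empty \<open>I\<close>.\<close>
  define \<kappa> where "\<kappa> = \<delta> / (2 * (real (card I) + 1))"
  have \<kappa>: "\<kappa> > 0" using \<open>\<delta> > 0\<close> by (simp add: \<kappa>_def add_nonneg_pos)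
  have \<kappa>_sum: "real (card I) * (2 * \<kappa>) \<le> \<delta>"
    using \<open>\<delta> > 0\<close> by (simp add: \<kappa>_def field_simps)

  \<comment> \<open>The sample size comes first, from Hoeffding's bound, which does not involve the
    box. The box size can then depend on \<open>l\<close>.\<close>
  have "((\<lambda>l. 2 * exp (- 2 * real l * \<eta>\<^sup>2 / (2 * A)\<^sup>2)) \<longlongrightarrow> 0) sequentially"
    using A \<eta> by real_asymp
  then have "eventually (\<lambda>l. 2 * exp (- 2 * real l * \<eta>\<^sup>2 / (2 * A)\<^sup>2) < \<kappa>) sequentially"
    using \<kappa> by (rule order_tendstoD)
  with eventually_ge_at_top[of 1]
  have "eventually (\<lambda>l. l \<ge> 1 \<and> 2 * exp (- 2 * real l * \<eta>\<^sup>2 / (2 * A)\<^sup>2) < \<kappa>) sequentially"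
    by eventually_elim auto
  then obtain l where l: "l \<ge> 1" and hoeff: "2 * exp (- 2 * real l * \<eta>\<^sup>2 / (2 * A)\<^sup>2) < \<kappa>"
    using eventually_happens'[OF sequentially_bot] by blast

  \<comment> \<open>The level \<open>\<kappa> / real l\<close> lets the union over the
    \<open>l\<close> samples cost at most \<open>\<kappa>\<close> for each pair.\<close>
  have "eventually (\<lambda>N. \<forall>p\<in>I. measure D {x \<in> space D. \<bar>\<phi> x (fst p) (snd p)\<bar> \<ge> real (Suc N)} < \<kappa> / real l)
      sequentially"
    using finI \<kappa> l int
    by (intro eventually_ball_finite ballI order_tendstoD(2)[OF tail_probability_tendsto_0])
      (auto simp: I_def)
  then obtain N :: nat where
    N: "\<forall>p\<in>I. measure D {x \<in> space D. \<bar>\<phi> x (fst p) (snd p)\<bar> \<ge> real (Suc N)} < \<kappa> / real l"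
    using eventually_happens'[OF sequentially_bot] by blast
  define B where "B = real (Suc N)"

  \<comment> \<open>On a concatenation, coordinate \<open>j * d + i\<close> is component
    \<open>i\<close> of sample \<open>j\<close>, so \<open>h\<close> is the interpolant at the mean
    of the clamped samples.\<close>
  define h where "h x = ?L (\<lambda>i. (\<Sum>j<l. max (-A) (min A (x (j * d + i)))) / real l)" for x
  define K where "K = {x. (\<forall>k<d * l. \<bar>x k\<bar> \<le> B) \<and> (\<forall>k\<ge>d * l. x k = (0::real))}"
  have "continuous_map (powertop_real UNIV) euclideanreal h"
    using continuous_on_lagrange_interpolant_mean
    by (simp add: h_def euclidean_product_topology)
  then have "continuous_map (subtopology (Euclidean_space (d * l)) K) euclideanreal h"
    by (simp add: Euclidean_space_def continuous_map_from_subtopology)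
  with compactin_Euclidean_space_box[of "d * l" B, folded K_def]
  have "\<exists>g. mlp \<sigma> (d * l) g \<and> (\<forall>x\<in>K. \<bar>h x - g x\<bar> < \<epsilon> / 2)"
    using \<open>\<epsilon> > 0\<close> by (intro universal_activation_approximation[OF \<sigma>]) simp_all
  then obtain g where g: "mlp \<sigma> (d * l) g" and gh: "\<And>x. x \<in> K \<Longrightarrow> \<bar>h x - g x\<bar> < \<epsilon> / 2"
    by (elim exE conjE) simp

  have "measure M {\<omega> \<in> space M. \<forall>G\<in>S.
         \<bar>f G - g (concat_vec d l (\<lambda>i. \<phi> (X i \<omega>) G))\<bar> < \<epsilon>} \<ge> 1 - \<delta>"
    if M: "prob_space M" and indep: "prob_space.indep_vars M (\<lambda>_. D) X {..<l}"
      and distr: "\<forall>i<l. distr M D (X i) = D"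
    for M :: "'w measure" and X
  proof -
    interpret prob_space M by fact
    have X [measurable]: "X j \<in> measurable M D" if "j < l" for j
      using indep that by (auto simp: indep_vars_def)
    have \<phi>: "(\<lambda>x. \<phi> x G i) \<in> borel_measurable D" if "G \<in> S" "i < d" for G i
      using int[OF that] by auto
    have \<phi>X: "(\<lambda>\<omega>. \<phi> (X j \<omega>) G i) \<in> borel_measurable M" if "G \<in> S" "i < d" "j < l" for G i j
      by (rule measurable_compose[OF X[OF that(3)] \<phi>[OF that(1,2)]])
    let ?m = "\<lambda>G i \<omega>. (\<Sum>j<l. max (-A) (min A (\<phi> (X j \<omega>) G i))) / real l"
    define E where "E p = {\<omega> \<in> space M. \<bar>?m (fst p) (snd p) \<omega> - \<mu> (fst p) (snd p)\<bar> \<ge> \<eta>}" for p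
    define F where "F p j = {\<omega> \<in> space M. \<bar>\<phi> (X j \<omega>) (fst p) (snd p)\<bar> \<ge> B}" for p j
    \<comment> \<open>\<open>E p\<close> is a deviation of a clamped mean, \<open>F p j\<close> an
      unclamped sample coordinate reaching the boundary of the box or beyond.\<close>
    define bad where "bad = (\<Union>p\<in>I. E p \<union> (\<Union>j<l. F p j))"
    define good where "good = {\<omega> \<in> space M. \<forall>G\<in>S.
         \<bar>f G - g (concat_vec d l (\<lambda>i. \<phi> (X i \<omega>) G))\<bar> < \<epsilon>}"
    have E_sets [measurable]: "E p \<in> sets M" if "p \<in> I" for p
    proof -
      have "?m (fst p) (snd p) \<in> borel_measurable M"
        using that \<phi>X unfolding I_def
        by (intro borel_measurable_divide borel_measurable_sum borel_measurable_max
            borel_measurable_min borel_measurable_const) auto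
      then show ?thesis unfolding E_def by measurable
    qed
    have F_sets [measurable]: "F p j \<in> sets M" if "p \<in> I" "j < l" for p j
    proof -
      have "(\<lambda>\<omega>. \<phi> (X j \<omega>) (fst p) (snd p)) \<in> borel_measurable M"
        using that \<phi>X by (auto simp: I_def)
      then show ?thesis unfolding F_def by measurable
    qed
    \<comment> \<open>Needed for monotonicity: the bound on \<open>bad\<close> carries over to
      \<open>good\<close> only if \<open>good\<close> is an event.\<close>
    have good_sets: "good \<in> sets M"
    proof -
      have "(\<lambda>\<omega>. g (concat_vec d l (\<lambda>i. \<phi> (X i \<omega>) G))) \<in> borel_measurable M" if "G \<in> S" for G
      proof (rule mlp_measurable[OF g])
        show "\<sigma> \<in> borel_measurable borel"
          using \<sigma> by (simp add: universal_activation_def)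
        fix k assume k: "k < d * l"
        then obtain i j where "i < d" "j < l" "\<forall>v. concat_vec d l v k = v j i"
          using concat_vec_cases by blast
        with that show "(\<lambda>\<omega>. concat_vec d l (\<lambda>i. \<phi> (X i \<omega>) G) k) \<in> borel_measurable M"
          by (simp add: \<phi>X)
      qed
      then have "{\<omega> \<in> space M. \<bar>f G - g (concat_vec d l (\<lambda>i. \<phi> (X i \<omega>) G))\<bar> < \<epsilon>} \<in> sets M"
        if "G \<in> S" for G
        using that by measurable
      then show ?thesis
        unfolding good_def using \<open>finite S\<close> by (intro sets.sets_Collect_finite_All) auto
    qed
    have probE: "prob (E p) \<le> \<kappa>" if "p \<in> I" for p
    proof -
      have "(\<lambda>x. max (-A) (min A (\<phi> x (fst p) (snd p)))) \<in> borel_measurable D"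
        using that \<phi> by (auto simp: I_def)
      then have "prob (E p) \<le> 2 * exp (- 2 * real l * \<eta>\<^sup>2 / (2 * A)\<^sup>2)"
        unfolding E_def \<mu>_def using A \<eta> l distr
        by (intro empirical_mean_concentration[OF indep]) auto
      with hoeff show ?thesis by simp
    qed
    have probF: "prob (F p j) \<le> \<kappa> / real l" if "p \<in> I" "j < l" for p j
    proof -
      have "(\<lambda>x. \<phi> x (fst p) (snd p)) \<in> borel_measurable D"
        using that \<phi> by (auto simp: I_def)
      then have "{x \<in> space D. \<bar>\<phi> x (fst p) (snd p)\<bar> \<ge> B} \<in> sets D"
        by measurable
      then have "measure (distr M D (X j)) {x \<in> space D. \<bar>\<phi> x (fst p) (snd p)\<bar> \<ge> B} =
          prob (X j -` {x \<in> space D. \<bar>\<phi> x (fst p) (snd p)\<bar> \<ge> B} \<inter> space M)"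
        using X[OF that(2)] by (intro measure_distr)
      also have "X j -` {x \<in> space D. \<bar>\<phi> x (fst p) (snd p)\<bar> \<ge> B} \<inter> space M = F p j"
        using measurable_space[OF X[OF that(2)]] by (auto simp: F_def)
      finally show ?thesis
        using N[rule_format, OF that(1)] distr that(2) by (simp add: B_def)
    qed
    have "prob bad \<le> (\<Sum>p\<in>I. prob (E p \<union> (\<Union>j<l. F p j)))"
      unfolding bad_def using finI by (intro finite_measure_subadditive_finite) auto
    also have "\<dots> \<le> (\<Sum>p\<in>I. 2 * \<kappa>)"
    proof (rule sum_mono)
      fix p assume p: "p \<in> I"
      have "prob (\<Union>j<l. F p j) \<le> (\<Sum>j<l. prob (F p j))"
        using p by (intro finite_measure_subadditive_finite) auto
      also have "\<dots> \<le> (\<Sum>j<l. \<kappa> / real l)"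
        using p by (intro sum_mono probF) auto
      also have "\<dots> = \<kappa>"
        using l by simp
      finally have "prob (\<Union>j<l. F p j) \<le> \<kappa>" .
      moreover have "prob (E p \<union> (\<Union>j<l. F p j)) \<le> prob (E p) + prob (\<Union>j<l. F p j)"
        using p by (intro measure_Un_le) auto
      ultimately show "prob (E p \<union> (\<Union>j<l. F p j)) \<le> 2 * \<kappa>"
        using probE[OF p] by simp
    qed
    also have "\<dots> \<le> \<delta>"
      using \<kappa>_sum by simp
    finally have "prob bad \<le> \<delta>" .
    have bad_sets: "bad \<in> sets M"
      unfolding bad_def using finI by (intro sets.finite_UN sets.Un) auto
    \<comment> \<open>Outside \<open>bad\<close> the concatenation lies in \<open>K\<close>, so
      \<open>g\<close> is within \<epsilon>/2 of \<open>h\<close>; the means are within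
      \<open>\<eta>\<close>, so \<open>h\<close> is within \<epsilon>/2 of
      \<open>f G\<close>.\<close>
    have "space M - bad \<subseteq> good"
    proof
      fix \<omega> assume \<omega>: "\<omega> \<in> space M - bad"
      have "\<bar>f G - g (concat_vec d l (\<lambda>i. \<phi> (X i \<omega>) G))\<bar> < \<epsilon>" if G: "G \<in> S" for G
      proof -
        let ?x = "concat_vec d l (\<lambda>i. \<phi> (X i \<omega>) G)"
        have mean: "\<bar>?m G i \<omega> - \<mu> G i\<bar> < \<eta>" if "i < d" for i
          using \<omega> G that by (force simp: bad_def E_def I_def)
        have bound: "\<bar>\<phi> (X j \<omega>) G i\<bar> \<le> B" if "i < d" "j < l" for i j
          using \<omega> G that by (force simp: bad_def F_def I_def)
        have "\<bar>?x k\<bar> \<le> B" if "k < d * l" for k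
          using that bound by (metis concat_vec_cases)
        then have "?x \<in> K"
          by (simp add: K_def concat_vec_def)
        then have "\<bar>h ?x - g ?x\<bar> < \<epsilon> / 2"
          by (rule gh)
        moreover have "\<bar>h ?x - f G\<bar> < \<epsilon> / 2"
          unfolding h_def using G mean by (intro near) (simp_all add: concat_vec_nth)
        ultimately show ?thesis
          by linarith
      qed
      with \<omega> show "\<omega> \<in> good"
        by (simp add: good_def)
    qed
    then have "prob (space M - bad) \<le> prob good"
      using good_sets by (intro finite_measure_mono)
    then show ?thesis
      using \<open>prob bad \<le> \<delta>\<close> prob_compl[OF bad_sets] by (simp add: good_def)
  qed
  then show ?thesis
    using l g by blast
qed

theorem theorem4:
  fixes n d :: nat
    and \<G> :: "nat pair_pre_digraph set"
    and D :: "'x measure"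
    and \<phi> :: "'x \<Rightarrow> nat pair_pre_digraph \<Rightarrow> nat \<Rightarrow> real"
    and f :: "nat pair_pre_digraph \<Rightarrow> real"
    and \<sigma> :: "real \<Rightarrow> real"
    and \<epsilon> \<delta> :: real
  assumes "graph_representatives n \<G>"
    and "random_graph_embedding D d \<G> \<phi>"
    and "expectation_complete D \<G> \<phi>"
    and "permutation_invariant_on \<G> f"
    and "universal_activation \<sigma>"
    and "\<epsilon> > 0" and "\<delta> > 0"
  shows "\<exists>l\<ge>1. \<exists>g. mlp \<sigma> (d * l) g \<and>
    (\<forall>(M :: 'w measure) X.
       prob_space M \<longrightarrow>
       prob_space.indep_vars M (\<lambda>_. D) X {..<l} \<longrightarrow>
       (\<forall>i<l. distr M D (X i) = D) \<longrightarrow>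
       measure M {\<omega> \<in> space M. \<forall>G\<in>\<G>.
         \<bar>f G - g (concat_vec d l (\<lambda>i. \<phi> (X i \<omega>) G))\<bar> < \<epsilon>} \<ge> 1 - \<delta>)"
proof (rule mlp_approximation_of_separating_embedding)
  show "finite \<G>"
    using assms(1) by (rule finite_graph_representatives)
  show "\<And>G i. G \<in> \<G> \<Longrightarrow> i < d \<Longrightarrow> integrable D (\<lambda>x. \<phi> x G i)"
    using assms(2) by (auto simp: random_graph_embedding_def)
  show "\<exists>i<d. (\<integral>x. \<phi> x G i \<partial>D) \<noteq> (\<integral>x. \<phi> x H i \<partial>D)"
    if GH: "G \<in> \<G>" "H \<in> \<G>" "G \<noteq> H" for G H
  proof -
    \<comment> \<open>Distinct representatives lie in distinct classes, so completeness separates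
      their expectations.\<close>
    have "\<not> graph_iso G H"
      using graph_representatives_iso_eq assms(1) GH by blast
    then have "expected_embedding D \<phi> G \<noteq> expected_embedding D \<phi> H"
      using assms(3) GH by (auto simp: expectation_complete_def complete_on_def)
    then obtain i where i: "(\<integral>x. \<phi> x G i \<partial>D) \<noteq> (\<integral>x. \<phi> x H i \<partial>D)"
      by (auto simp: expected_embedding_def)
    \<comment> \<open>Embedding values vanish at indices from \<open>d\<close> on, so both
      expectations are 0 there and cannot differ.\<close>
    have "i < d"
    proof (rule ccontr)
      assume "\<not> i < d"
      then have "(\<integral>x. \<phi> x K i \<partial>D) = (\<integral>x. 0 \<partial>D)" if "K \<in> \<G>" for K
        using assms(2) that
        by (intro Bochner_Integration.integral_cong)
          (auto simp: random_graph_embedding_def topspace_Euclidean_space)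
      then show False
        using i GH by simp
    qed
    with i show ?thesis by blast
  qed
qed (use assms in auto)

end
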